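(* Fix integers $t\ge s\ge0$ and an assignment rule $\mathcal X$. For any non-negative measurable function $u:\mathbb Y^t\to[0,\infty]$, $$\mathsf E\big[u(Y_1,\dots,Y_t);\ \Theta_{\mathcal X}=s\big]=\mathsf E\big[u(Y_1,\dots,Y_t)\,\mathsf R^s_t;\ \Theta_{\mathcal X}>t\big],\qquad\text{where}\quad \mathsf R^s_t=\Pi_s\prod_{j=s}^t\frac{\Lambda_j}{1-\Pi_j}.$$
   Context: Setup. Fix $2\le K<\infty$, $[K]=\{1,\dots,K\}$, $\mathbb N=\{1,2,\dots\}$. There is a latent process $L_t\in\{0,1\}$, $t\ge0$, with $L_t=0$ for $t<\Theta$ and $L_t=1$ for $t\ge\Theta$ ($\Theta=\Theta_{\mathcal X}$ is the change-point). At each $t\in\mathbb N$ a treatment $X_t\in[K]$ is selected and a response $Y_t$ in a Polish space $\mathbb Y$ is observed; $\mathcal F_t=\sigma(X_s,Y_s:1\le s\le t)$, $\mathcal F_0$ trivial. An assignment rule $\mathcal X=\{X_t\}$ has $X_1$ deterministic and $X_t$ a measurable function of $X_1,\dots,X_{t-1},Y_1,\dots,Y_{t-1}$. Response model: for each $x\in[K]$, $f_x,g_x$ are densities with respect to a $\sigma$-finite measure $\mu$ on $\mathbb Y$; given $X_t=x,L_t=i,\mathcal F_{t-1},L_0,\dots,L_{t-1}$, $Y_t$ has density $f_x$ if $i=0$, $g_x$ if $i=1$. The likelihood ratios $g_x/f_x$ are assumed well defined, i.e. $f_x$ and $g_x$ vanish on the same set up to a $\mu$-null set. Change-point model: $\pi_0\in[0,1)$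 and functions $\pi_t:[K]^t\to[0,1)$ with $\mathsf P(L_0=1)=\pi_0$ and $\mathsf P(L_t=1\mid L_{t-1}=0,\mathcal F_{t-1},X_t)=\Pi_t:=\pi_t(X_1,\dots,X_t)$ for $t\ge1$; $\Pi_0:=\pi_0$. $\Lambda_0:=1$ and $\Lambda_t:=g_{X_t}(Y_t)/f_{X_t}(Y_t)$ for $t\ge1$. $\mathsf E[Z;A]$ means $\mathsf E[Z\mathbf 1_A]$. *)

theory Defs
  imports "HOL-Probability.Probability"
begin

text \<open>
  Treatments are the natural numbers \<open>1, \<dots>, K\<close>, and a tuple indexed by \<open>1, \<dots>, t\<close> is an
  extensional function on \<open>{1..t}\<close>. The change-point is an \<open>enat\<close>, since it need not be finite.
\<close>

definition latent :: "('a \<Rightarrow> enat) \<Rightarrow> nat \<Rightarrow> 'a \<Rightarrow> nat" where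
  "latent \<theta> t w = (if enat t < \<theta> w then 0 else 1)"

definition assignment_rule ::
  "'a measure \<Rightarrow> nat \<Rightarrow> (nat \<Rightarrow> 'a \<Rightarrow> nat) \<Rightarrow> (nat \<Rightarrow> 'a \<Rightarrow> 'y :: topological_space) \<Rightarrow> bool" where
  "assignment_rule M K X Y \<longleftrightarrow>
     (\<exists>x\<in>{1..K}. \<forall>w\<in>space M. X 1 w = x) \<and>
     (\<forall>t\<ge>2. \<exists>a \<in> measurable
          (Pi\<^sub>M {1..<t} (\<lambda>_. count_space {1..K}) \<Otimes>\<^sub>M Pi\<^sub>M {1..<t} (\<lambda>_. borel)) (count_space {1..K}).
        \<forall>w\<in>space M. X t w = a (\<lambda>i\<in>{1..<t}. X i w, \<lambda>i\<in>{1..<t}. Y i w))"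

definition obs_alg ::
  "'a measure \<Rightarrow> (nat \<Rightarrow> 'a \<Rightarrow> nat) \<Rightarrow> (nat \<Rightarrow> 'a \<Rightarrow> 'y :: topological_space) \<Rightarrow> nat \<Rightarrow> 'a measure" where
  "obs_alg M X Y t = sigma (space M)
     (\<Union>s\<in>{1..t}. sets (vimage_algebra (space M) (X s) (count_space UNIV)) \<union>
                 sets (vimage_algebra (space M) (Y s) borel))"

text \<open>
  \<open>trans_alg\<close> is generated by \<open>L\<^sub>t\<^sub>-\<^sub>1\<close>, the observations up to time \<open>t - 1\<close> and \<open>X\<^sub>t\<close>;
  \<open>resp_alg\<close> by \<open>L\<^sub>0, \<dots>, L\<^sub>t\<close>, the observations up to time \<open>t - 1\<close> and \<open>X\<^sub>t\<close>.
  Both are used for \<open>t \<ge> 1\<close> only.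
\<close>

definition trans_alg ::
  "'a measure \<Rightarrow> (nat \<Rightarrow> 'a \<Rightarrow> nat) \<Rightarrow> (nat \<Rightarrow> 'a \<Rightarrow> 'y :: topological_space) \<Rightarrow> ('a \<Rightarrow> enat)
     \<Rightarrow> nat \<Rightarrow> 'a measure" where
  "trans_alg M X Y \<theta> t = sigma (space M)
     (sets (obs_alg M X Y (t - 1)) \<union>
      sets (vimage_algebra (space M) (X t) (count_space UNIV)) \<union>
      sets (vimage_algebra (space M) (latent \<theta> (t - 1)) (count_space UNIV)))"

definition resp_alg ::
  "'a measure \<Rightarrow> (nat \<Rightarrow> 'a \<Rightarrow> nat) \<Rightarrow> (nat \<Rightarrow> 'a \<Rightarrow> 'y :: topological_space) \<Rightarrow> ('a \<Rightarrow> enat)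
     \<Rightarrow> nat \<Rightarrow> 'a measure" where
  "resp_alg M X Y \<theta> t = sigma (space M)
     (sets (obs_alg M X Y (t - 1)) \<union>
      sets (vimage_algebra (space M) (X t) (count_space UNIV)) \<union>
      (\<Union>r\<in>{0..t}. sets (vimage_algebra (space M) (latent \<theta> r) (count_space UNIV))))"

text \<open>The transition probability \<open>\<Pi>\<^sub>t = \<pi>\<^sub>t(X\<^sub>1, \<dots>, X\<^sub>t)\<close>.\<close>

definition trans_prob ::
  "(nat \<Rightarrow> (nat \<Rightarrow> nat) \<Rightarrow> real) \<Rightarrow> (nat \<Rightarrow> 'a \<Rightarrow> nat) \<Rightarrow> nat \<Rightarrow> 'a \<Rightarrow> real" where
  "trans_prob \<pi> X t w = \<pi> t (\<lambda>i\<in>{1..t}. X i w)"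

definition lik_ratio ::
  "(nat \<Rightarrow> 'y \<Rightarrow> real) \<Rightarrow> (nat \<Rightarrow> 'y \<Rightarrow> real) \<Rightarrow> (nat \<Rightarrow> 'a \<Rightarrow> nat) \<Rightarrow> (nat \<Rightarrow> 'a \<Rightarrow> 'y)
     \<Rightarrow> nat \<Rightarrow> 'a \<Rightarrow> real" where
  "lik_ratio f g X Y t w = (if t = 0 then 1 else g (X t w) (Y t w) / f (X t w) (Y t w))"

text \<open>The statistic \<open>R\<^sup>s\<^sub>t\<close>.\<close>

definition R_stat ::
  "(nat \<Rightarrow> 'y \<Rightarrow> real) \<Rightarrow> (nat \<Rightarrow> 'y \<Rightarrow> real) \<Rightarrow> (nat \<Rightarrow> (nat \<Rightarrow> nat) \<Rightarrow> real)
     \<Rightarrow> (nat \<Rightarrow> 'a \<Rightarrow> nat) \<Rightarrow> (nat \<Rightarrow> 'a \<Rightarrow> 'y) \<Rightarrow> nat \<Rightarrow> nat \<Rightarrow> 'a \<Rightarrow> real" where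
  "R_stat f g \<pi> X Y s t w =
     trans_prob \<pi> X s w * (\<Prod>j=s..t. lik_ratio f g X Y j w / (1 - trans_prob \<pi> X j w))"

definition is_density :: "'y measure \<Rightarrow> ('y \<Rightarrow> real) \<Rightarrow> bool" where
  "is_density \<mu> h \<longleftrightarrow>
     h \<in> borel_measurable \<mu> \<and> (\<forall>y. 0 \<le> h y) \<and> (\<integral>\<^sup>+y. ennreal (h y) \<partial>\<mu>) = 1"

text \<open>
  Measurability of the treatments is not listed: it follows from \<open>rule_X\<close> and \<open>meas_Y\<close>.
  The function \<open>\<lambda>_. undefined\<close> in \<open>init_L\<close> is the empty tuple, so that \<open>init_L\<close> concerns \<open>\<pi>\<^sub>0\<close>.
\<close>

locale changepoint_model = prob_space M + \<mu>: sigma_finite_measure \<mu>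
  for M :: "'a measure" and \<mu> :: "'y :: polish_space measure" +
  fixes K :: nat
    and f g :: "nat \<Rightarrow> 'y \<Rightarrow> real"
    and \<pi> :: "nat \<Rightarrow> (nat \<Rightarrow> nat) \<Rightarrow> real"
    and X :: "nat \<Rightarrow> 'a \<Rightarrow> nat"
    and Y :: "nat \<Rightarrow> 'a \<Rightarrow> 'y"
    and \<theta> :: "'a \<Rightarrow> enat"
  assumes K_ge_2: "2 \<le> K"
    and sets_mu: "sets \<mu> = sets borel"
    and dens_f: "\<And>x. x \<in> {1..K} \<Longrightarrow> is_density \<mu> (f x)"
    and dens_g: "\<And>x. x \<in> {1..K} \<Longrightarrow> is_density \<mu> (g x)"
    and same_zeros: "\<And>x. x \<in> {1..K} \<Longrightarrow> AE y in \<mu>. f x y = 0 \<longleftrightarrow> g x y = 0"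
    and pi_range: "\<And>t x. x \<in> {1..t} \<rightarrow>\<^sub>E {1..K} \<Longrightarrow> \<pi> t x \<in> {0..<1}"
    and meas_theta: "\<theta> \<in> measurable M (count_space UNIV)"
    and meas_Y: "\<And>t. 1 \<le> t \<Longrightarrow> Y t \<in> borel_measurable M"
    and rule_X: "assignment_rule M K X Y"
    and init_L: "prob {w \<in> space M. latent \<theta> 0 w = 1} = \<pi> 0 (\<lambda>_. undefined)"
    and trans_L: "\<And>t. 1 \<le> t \<Longrightarrow>
      AE w in M. latent \<theta> (t - 1) w = 0 \<longrightarrow>
        real_cond_exp M (trans_alg M X Y \<theta> t) (indicator {v \<in> space M. latent \<theta> t v = 1}) w
          = trans_prob \<pi> X t w"
    and resp_Y: "\<And>t B. 1 \<le> t \<Longrightarrow> B \<in> sets borel \<Longrightarrow>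
      AE w in M.
        real_cond_exp M (resp_alg M X Y \<theta> t) (indicator {v \<in> space M. Y t v \<in> B}) w
          = measure (density \<mu>
              (\<lambda>y. ennreal (if latent \<theta> t w = 0 then f (X t w) y else g (X t w) y))) B"

end

theory Submission
  imports Defs
begin

text \<open>
  The identity is proved for every non-negative \<open>\<F>\<^sub>t\<close>-measurable \<open>h\<close> in place of
  \<open>u(Y\<^sub>1, \<dots>, Y\<^sub>t)\<close>, by induction on \<open>t\<close>. By a \<open>\<pi>\<close>-system argument it suffices to take
  \<open>h = 1\<^sub>A 1\<^sub>B(Y\<^sub>t)\<close> with \<open>A \<in> \<F>\<^sub>t\<^sub>-\<^sub>1\<close>. On \<open>{\<Theta> = s}\<close> the response model replaces \<open>1\<^sub>B(Y\<^sub>t)\<close> by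
  \<open>G(X\<^sub>t)\<close>, the integral of \<open>g\<close> over \<open>B\<close>, which is \<open>\<F>\<^sub>t\<^sub>-\<^sub>1\<close>-measurable. The induction hypothesis (or, for
  \<open>s = t\<close>, the transition model) and the factor \<open>1 / (1 - \<Pi>\<^sub>t)\<close> for survival at time \<open>t\<close> move the
  integral to \<open>{\<Theta> > t}\<close>, where \<open>G(X\<^sub>t)\<close> turns back into \<open>1\<^sub>B(Y\<^sub>t) \<Lambda>\<^sub>t\<close> because
  \<open>g = (g / f) f\<close> almost everywhere.
\<close>

section \<open>Generators and conditional probabilities\<close>

lemma nn_integral_eq_from_Int_stable:
  fixes D1 D2 :: "'a \<Rightarrow> ennreal"
  assumes [measurable]: "D1 \<in> borel_measurable M" "D2 \<in> borel_measurable M"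
    and E: "Int_stable E" "E \<subseteq> sets M" "space M \<in> E"
    and gen: "space N = space M" "sets N \<subseteq> sigma_sets (space M) E"
    and eq: "\<And>A. A \<in> E \<Longrightarrow> (\<integral>\<^sup>+w. indicator A w * D1 w \<partial>M) = (\<integral>\<^sup>+w. indicator A w * D2 w \<partial>M)"
    and fin: "(\<integral>\<^sup>+w. D1 w \<partial>M) < \<infinity>"
    and h_N: "h \<in> borel_measurable N"
  shows "(\<integral>\<^sup>+w. h w * D1 w \<partial>M) = (\<integral>\<^sup>+w. h w * D2 w \<partial>M)"
proof -
  have Pow: "E \<subseteq> Pow (space M)"
    using E(2) sets.sets_into_space by auto
  define N' where "N' = sigma (space M) E"
  have N: "space N' = space M" "sets N' = sigma_sets (space M) E"
    using Pow by (auto simp: N'_def)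
  have h: "h \<in> borel_measurable N'"
    by (rule measurable_from_subalg[OF _ h_N]) (use gen N in \<open>auto simp: subalgebra_def\<close>)
  have sub: "sets N' \<subseteq> sets M"
    unfolding N(2) by (rule sets.sigma_sets_subset) (use E(2) in auto)
  have id: "id \<in> measurable M N'"
    using sub by (auto simp: measurable_def N(1) dest: sets.sets_into_space intro: Int_absorb2[THEN ssubst])
  have hM [measurable]: "h \<in> borel_measurable M"
    using measurable_compose[OF id h] by simp
  have "distr (density M D1) N' id = distr (density M D2) N' id"
  proof (rule measure_eqI_generator_eq[of E "space M" _ _ "\<lambda>_. space M"])
    show "Int_stable E" "E \<subseteq> Pow (space M)"
      using E sets.sets_into_space by auto
    show "sets (distr (density M D1) N' id) = sigma_sets (space M) E"
      "sets (distr (density M D2) N' id) = sigma_sets (space M) E"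
      by (auto simp: N)
    show "range (\<lambda>_. space M) \<subseteq> E" "(\<Union>i::nat. space M) = space M"
      using E by auto
    have em: "emeasure (distr (density M D) N' id) A = (\<integral>\<^sup>+w. indicator A w * D w \<partial>M)"
      if [measurable]: "D \<in> borel_measurable M" and A: "A \<in> E" for D A
    proof -
      have AM: "A \<in> sets M" using A E by auto
      have AN: "A \<in> sets N'" using A by (auto simp: N)
      have "id -` A \<inter> space M = A" using sets.sets_into_space[OF AM] by auto
      then have "emeasure (distr (density M D) N' id) A = emeasure (density M D) A"
        using AN id by (subst emeasure_distr) auto
      then show ?thesis
        using AM by (simp add: emeasure_density mult.commute)
    qed
    show "emeasure (distr (density M D1) N' id) A = emeasure (distr (density M D2) N' id) A"
      if "A \<in> E" for A
      using that by (simp add: em eq)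
    have "(\<integral>\<^sup>+w. indicator (space M) w * D1 w \<partial>M) = (\<integral>\<^sup>+w. D1 w \<partial>M)"
      by (rule nn_integral_cong) simp
    then show "emeasure (distr (density M D1) N' id) (space M) \<noteq> \<infinity>" for i :: nat
      using fin E by (simp add: em)
  qed
  then have "(\<integral>\<^sup>+w. h w \<partial>distr (density M D1) N' id) = (\<integral>\<^sup>+w. h w \<partial>distr (density M D2) N' id)"
    by simp
  moreover have "(\<integral>\<^sup>+w. h w \<partial>distr (density M D) N' id) = (\<integral>\<^sup>+w. h w * D w \<partial>M)"
    if [measurable]: "D \<in> borel_measurable M" for D
    using id h by (simp add: nn_integral_distr nn_integral_density mult.commute)
  ultimately show ?thesis by simp
qed

context prob_space
begin

lemma subalgebra_sigma_finite:
  assumes "subalgebra M F"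
  shows "sigma_finite_subalgebra M F"
  using assms by (intro finite_measure_subalgebra_is_sigma_finite finite_measure_subalgebra.intro
    finite_measure_subalgebra_axioms.intro) unfold_locales

lemma AE_nn_cond_exp_indicator:
  assumes F: "subalgebra M F" and [measurable]: "C \<in> sets M"
  shows "AE w in M. nn_cond_exp M F (indicator C) w = ennreal (real_cond_exp M F (indicator C) w)"
proof -
  interpret F: sigma_finite_subalgebra M F using F by (rule subalgebra_sigma_finite)
  have le: "AE w in M. nn_cond_exp M F (indicator C) w \<le> nn_cond_exp M F (\<lambda>_. 1) w"
    by (rule F.nn_cond_exp_mono) (auto simp: indicator_def)
  have one: "AE w in M. 1 = nn_cond_exp M F (\<lambda>_. 1) w"
    by (rule F.nn_cond_exp_F_meas) auto
  have zero: "AE w in M. 0 = nn_cond_exp M F (\<lambda>_. 0) w"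
    by (rule F.nn_cond_exp_F_meas) auto
  have eq: "(\<lambda>x. ennreal (indicator C x)) = indicator C"
    "(\<lambda>x. ennreal (- indicator C x)) = (\<lambda>_. 0)"
    by (auto simp: indicator_def ennreal_neg)
  show ?thesis
    using le one zero
  proof eventually_elim
    case (elim w)
    then have "nn_cond_exp M F (indicator C) w < top"
      by (metis ennreal_one_less_top order_le_less_trans)
    with elim show ?case
      by (simp add: real_cond_exp_def eq)
  qed
qed

lemma nn_integral_cond_prob:
  assumes F: "subalgebra M F" and [measurable]: "C \<in> sets M"
    and Z: "Z \<in> borel_measurable F"
    and q: "AE w in M. Z w \<noteq> 0 \<longrightarrow> real_cond_exp M F (indicator C) w = q w"
  shows "(\<integral>\<^sup>+w. Z w * indicator C w \<partial>M) = (\<integral>\<^sup>+w. Z w * ennreal (q w) \<partial>M)"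
proof -
  interpret F: sigma_finite_subalgebra M F using F by (rule subalgebra_sigma_finite)
  have "(\<integral>\<^sup>+w. Z w * indicator C w \<partial>M) = (\<integral>\<^sup>+w. Z w * nn_cond_exp M F (indicator C) w \<partial>M)"
    by (rule F.nn_cond_exp_intg[symmetric]) (use Z in auto)
  also have "\<dots> = (\<integral>\<^sup>+w. Z w * ennreal (q w) \<partial>M)"
    by (rule nn_integral_cong_AE) (use AE_nn_cond_exp_indicator[OF F, of C] q in auto)
  finally show ?thesis .
qed

lemma real_cond_exp_compl:
  assumes F: "subalgebra M F" and [measurable]: "C \<in> sets M"
  shows "AE w in M. real_cond_exp M F (indicator (space M - C)) w = 1 - real_cond_exp M F (indicator C) w"
proof -
  interpret F: sigma_finite_subalgebra M F using F by (rule subalgebra_sigma_finite)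
  have "AE w in M. real_cond_exp M F (indicator (space M - C)) w = real_cond_exp M F (\<lambda>w. 1 - indicator C w) w"
    by (rule F.real_cond_exp_cong) (auto simp: indicator_def)
  moreover have "AE w in M. real_cond_exp M F (\<lambda>w. 1 - indicator C w) w =
      real_cond_exp M F (\<lambda>_. 1) w - real_cond_exp M F (indicator C) w"
    by (rule F.real_cond_exp_diff) (auto simp: integrable_indicator_iff emeasure_eq_measure)
  moreover have "AE w in M. real_cond_exp M F (\<lambda>_. 1) w = 1"
    by (rule F.real_cond_exp_F_meas) auto
  ultimately show ?thesis by eventually_elim simp
qed

end

lemma measurable_sigma_vimage:
  assumes "A \<subseteq> Pow \<Omega>" "sets (vimage_algebra \<Omega> h N) \<subseteq> A" "h \<in> \<Omega> \<rightarrow> space N"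
  shows "h \<in> measurable (sigma \<Omega> A) N"
proof (rule measurableI)
  fix B assume "B \<in> sets N"
  then have "h -` B \<inter> \<Omega> \<in> sets (vimage_algebra \<Omega> h N)"
    by (rule in_vimage_algebra)
  then show "h -` B \<inter> space (sigma \<Omega> A) \<in> sets (sigma \<Omega> A)"
    using assms by (auto simp: space_measure_of_conv sets_measure_of)
qed (use assms in \<open>auto simp: space_measure_of_conv\<close>)

lemma measurable_count_space_restrict:
  assumes "h \<in> measurable N (count_space UNIV)" "h \<in> space N \<rightarrow> A"
  shows "h \<in> measurable N (count_space A)"
  using assms by (auto simp: measurable_def)

lemma vimage_algebra_subset_Pow: "sets (vimage_algebra \<Omega> h N) \<subseteq> Pow \<Omega>"
  using sets.space_closed[of "vimage_algebra \<Omega> h N"] by simp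

lemma subalgebra_sigma:
  assumes "A \<subseteq> sets M"
  shows "subalgebra M (sigma (space M) A)"
proof -
  have "A \<subseteq> Pow (space M)"
    using assms sets.space_closed by (rule subset_trans)
  then show ?thesis
    using sets.sigma_sets_subset[OF assms] by (simp add: subalgebra_def)
qed

lemma measurable_mono_sets:
  assumes "h \<in> measurable F N" "space F = space G" "sets F \<subseteq> sets G"
  shows "h \<in> measurable G N"
  using assms by (intro measurable_from_subalg[of G F]) (auto simp: subalgebra_def)

section \<open>Measurability of the observed process\<close>

context changepoint_model
begin

abbreviation "obs \<equiv> obs_alg M X Y"
abbreviation "trans_alg_at \<equiv> trans_alg M X Y \<theta>"
abbreviation "resp_alg_at \<equiv> resp_alg M X Y \<theta>"

lemma measurable_treatment:
  assumes t: "1 \<le> t" and N: "space N = space M"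
    and X: "\<And>i. i \<in> {1..<t} \<Longrightarrow> X i \<in> measurable N (count_space {1..K})"
    and Y: "\<And>i. i \<in> {1..<t} \<Longrightarrow> Y i \<in> borel_measurable N"
  shows "X t \<in> measurable N (count_space {1..K})"
proof (cases "t = 1")
  case True
  obtain x where "x \<in> {1..K}" "\<And>w. w \<in> space M \<Longrightarrow> X 1 w = x"
    using rule_X by (auto simp: assignment_rule_def)
  then show ?thesis
    using True by (subst measurable_cong[of _ _ "\<lambda>_. x"]) (auto simp: N)
next
  case False
  then obtain a where a: "a \<in> measurable
          (Pi\<^sub>M {1..<t} (\<lambda>_. count_space {1..K}) \<Otimes>\<^sub>M Pi\<^sub>M {1..<t} (\<lambda>_. borel)) (count_space {1..K})"
    and eq: "\<And>w. w \<in> space M \<Longrightarrow> X t w = a (\<lambda>i\<in>{1..<t}. X i w, \<lambda>i\<in>{1..<t}. Y i w)"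
    using t rule_X unfolding assignment_rule_def by (metis One_nat_def Suc_1 Suc_leI le_neq_implies_less)
  have "(\<lambda>w. (\<lambda>i\<in>{1..<t}. X i w, \<lambda>i\<in>{1..<t}. Y i w)) \<in> measurable N
      (Pi\<^sub>M {1..<t} (\<lambda>_. count_space {1..K}) \<Otimes>\<^sub>M Pi\<^sub>M {1..<t} (\<lambda>_. borel))"
    by (intro measurable_Pair measurable_restrict X Y)
  from measurable_compose[OF this a] show ?thesis
    by (subst measurable_cong[OF eq]) (auto simp: N)
qed

lemma measurable_X: "1 \<le> t \<Longrightarrow> X t \<in> measurable M (count_space {1..K})"
proof (induction t rule: less_induct)
  case (less t)
  show ?case
    by (rule measurable_treatment) (use less meas_Y in auto)
qed

lemma X_range: "1 \<le> t \<Longrightarrow> w \<in> space M \<Longrightarrow> X t w \<in> {1..K}"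
  using measurable_space[OF measurable_X] by auto

lemma measurable_latent: "latent \<theta> t \<in> measurable M (count_space UNIV)"
  unfolding latent_def using meas_theta by measurable

lemma generators_X: "1 \<le> t \<Longrightarrow> sets (vimage_algebra (space M) (X t) (count_space UNIV)) \<subseteq> sets M"
  by (rule sets_image_in_sets[OF refl], rule measurable_compose[OF measurable_X]) auto

lemma generators_Y: "1 \<le> t \<Longrightarrow> sets (vimage_algebra (space M) (Y t) borel) \<subseteq> sets M"
  by (rule sets_image_in_sets[OF refl meas_Y])

lemma generators_latent:
  "sets (vimage_algebra (space M) (latent \<theta> t) (count_space UNIV)) \<subseteq> sets M"
  by (rule sets_image_in_sets[OF refl measurable_latent])

lemma subalgebra_obs: "subalgebra M (obs t)"
  unfolding obs_alg_def
  by (rule subalgebra_sigma) (intro UN_least Un_least generators_X generators_Y; simp)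

lemma space_obs [simp]: "space (obs t) = space M"
  using subalgebra_obs by (simp add: subalgebra_def)

lemma sets_obs: "sets (obs t) \<subseteq> sets M"
  using subalgebra_obs by (simp add: subalgebra_def)

lemma subalgebra_trans: "1 \<le> t \<Longrightarrow> subalgebra M (trans_alg_at t)"
  unfolding trans_alg_def
  by (rule subalgebra_sigma) (intro Un_least generators_X generators_latent sets_obs; simp)

lemma subalgebra_resp: "1 \<le> t \<Longrightarrow> subalgebra M (resp_alg_at t)"
  unfolding resp_alg_def
  by (rule subalgebra_sigma) (intro UN_least Un_least generators_X generators_latent sets_obs; simp)

lemma obs_generators_Pow:
  "(\<Union>s\<in>{1..t}. sets (vimage_algebra (space M) (X s) (count_space UNIV)) \<union>
                 sets (vimage_algebra (space M) (Y s) borel)) \<subseteq> Pow (space M)"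
  by (intro UN_least Un_least vimage_algebra_subset_Pow)

lemma measurable_Y_obs: "i \<in> {1..t} \<Longrightarrow> Y i \<in> borel_measurable (obs t)"
  unfolding obs_alg_def
  by (rule measurable_sigma_vimage[OF obs_generators_Pow]) (rule SUP_upper2[where i = i], auto)

lemma measurable_X_obs: "i \<in> {1..t} \<Longrightarrow> X i \<in> measurable (obs t) (count_space {1..K})"
  unfolding obs_alg_def
  by (rule measurable_count_space_restrict, rule measurable_sigma_vimage[OF obs_generators_Pow])
     (rule SUP_upper2[where i = i], use X_range in \<open>auto simp: space_measure_of_conv\<close>)

lemma measurable_X_Suc_obs:
  assumes "i \<in> {1..Suc t}"
  shows "X i \<in> measurable (obs t) (count_space {1..K})"
proof (cases "i = Suc t")
  case True
  show ?thesis
    unfolding True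
    by (rule measurable_treatment) (auto simp del: One_nat_def intro!: measurable_X_obs measurable_Y_obs)
next
  case False
  then show ?thesis
    by (intro measurable_X_obs) (use assms in auto)
qed

lemma space_trans: "space (trans_alg_at (Suc t)) = space M"
  and space_resp: "space (resp_alg_at (Suc t)) = space M"
  using subalgebra_trans[of "Suc t"] subalgebra_resp[of "Suc t"] by (auto simp: subalgebra_def)

lemma trans_generators_Pow:
  "sets (obs t) \<union> sets (vimage_algebra (space M) (X (Suc t)) (count_space UNIV)) \<union>
     sets (vimage_algebra (space M) (latent \<theta> t) (count_space UNIV)) \<subseteq> Pow (space M)"
  using sets.space_closed[of "obs t"] by (intro Un_least vimage_algebra_subset_Pow) simp

lemma resp_generators_Pow:
  "sets (obs t) \<union> sets (vimage_algebra (space M) (X (Suc t)) (count_space UNIV)) \<union>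
     (\<Union>r\<in>{0..Suc t}. sets (vimage_algebra (space M) (latent \<theta> r) (count_space UNIV))) \<subseteq> Pow (space M)"
  using sets.space_closed[of "obs t"] by (intro Un_least UN_least vimage_algebra_subset_Pow) simp

lemma obs_le_trans: "sets (obs t) \<subseteq> sets (trans_alg_at (Suc t))"
  unfolding trans_alg_def diff_Suc_1 sets_measure_of[OF trans_generators_Pow]
  by (rule subset_trans[OF _ sigma_sets_superset_generator]) blast

lemma trans_le_resp: "sets (trans_alg_at (Suc t)) \<subseteq> sets (resp_alg_at (Suc t))"
  unfolding trans_alg_def resp_alg_def diff_Suc_1 sets_measure_of[OF trans_generators_Pow]
    sets_measure_of[OF resp_generators_Pow]
  by (rule sigma_sets_mono') (intro Un_mono subset_refl UN_upper, simp)

lemmas obs_trans = measurable_mono_sets[OF _ _ obs_le_trans, unfolded space_obs space_trans, OF _ refl]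
lemmas trans_resp = measurable_mono_sets[OF _ _ trans_le_resp, unfolded space_trans space_resp, OF _ refl]
lemmas resp_M = measurable_from_subalg[OF subalgebra_resp[of "Suc t" for t, simplified]]

lemma measurable_latent_trans: "latent \<theta> t \<in> measurable (trans_alg_at (Suc t)) (count_space UNIV)"
  unfolding trans_alg_def diff_Suc_1
  by (rule measurable_sigma_vimage[OF trans_generators_Pow]) auto

lemma measurable_latent_resp:
  assumes "i \<le> Suc t"
  shows "latent \<theta> i \<in> measurable (resp_alg_at (Suc t)) (count_space UNIV)"
  unfolding resp_alg_def diff_Suc_1
  by (rule measurable_sigma_vimage[OF resp_generators_Pow])
     (rule le_supI2, rule UN_upper[where a = i], use assms in auto)

lemma measurable_trans_prob:
  assumes "\<And>i. i \<in> {1..j} \<Longrightarrow> X i \<in> measurable N (count_space {1..K})"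
  shows "trans_prob \<pi> X j \<in> borel_measurable N"
proof -
  have "(\<lambda>w. \<lambda>i\<in>{1..j}. X i w) \<in> measurable N (Pi\<^sub>M {1..j} (\<lambda>_. count_space {1..K}))"
    by (intro measurable_restrict assms)
  also have "Pi\<^sub>M {1..j} (\<lambda>_. count_space {1..K}) = count_space ({1..j} \<rightarrow>\<^sub>E {1..K})"
    by (rule count_space_PiM_finite) auto
  finally have "(\<lambda>w. \<pi> j (\<lambda>i\<in>{1..j}. X i w)) \<in> borel_measurable N"
    by (rule measurable_compose) auto
  then show ?thesis
    by (simp add: trans_prob_def[abs_def])
qed

lemma trans_prob_range:
  assumes "w \<in> space M"
  shows "0 \<le> trans_prob \<pi> X t w" "trans_prob \<pi> X t w < 1"
proof -
  have "(\<lambda>i\<in>{1..t}. X i w) \<in> {1..t} \<rightarrow>\<^sub>E {1..K}"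
    using X_range assms by auto
  from pi_range[OF this] show "0 \<le> trans_prob \<pi> X t w" "trans_prob \<pi> X t w < 1"
    by (auto simp: trans_prob_def)
qed

lemma measurable_f [measurable]: "x \<in> {1..K} \<Longrightarrow> f x \<in> borel_measurable borel"
  and measurable_g [measurable]: "x \<in> {1..K} \<Longrightarrow> g x \<in> borel_measurable borel"
  using dens_f dens_g by (auto simp: is_density_def measurable_cong_sets[OF sets_mu refl])

lemma f_nonneg: "x \<in> {1..K} \<Longrightarrow> 0 \<le> f x y"
  and g_nonneg: "x \<in> {1..K} \<Longrightarrow> 0 \<le> g x y"
  using dens_f dens_g by (auto simp: is_density_def)

lemma lik_ratio_nonneg: "w \<in> space M \<Longrightarrow> 0 \<le> lik_ratio f g X Y t w"
  using f_nonneg[OF X_range, of t w] g_nonneg[OF X_range, of t w] by (auto simp: lik_ratio_def)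

lemma measurable_lik_ratio:
  assumes X: "1 \<le> j \<Longrightarrow> X j \<in> measurable N (count_space {1..K})"
    and Y: "1 \<le> j \<Longrightarrow> Y j \<in> borel_measurable N"
  shows "lik_ratio f g X Y j \<in> borel_measurable N"
proof (cases "j = 0")
  case False
  have "(\<lambda>w. g (X j w) (Y j w) / f (X j w) (Y j w)) \<in> borel_measurable N"
    by (rule measurable_compose_countable'[OF _ X, where f = "\<lambda>x w. g x (Y j w) / f x (Y j w)"])
       (use False in \<open>auto intro!: borel_measurable_divide measurable_compose[OF Y measurable_f]
          measurable_compose[OF Y measurable_g]\<close>)
  then show ?thesis
    using False by (simp add: lik_ratio_def[abs_def])
qed (simp add: lik_ratio_def[abs_def])

lemma measurable_R_stat: "R_stat f g \<pi> X Y s t \<in> borel_measurable (obs t)" if "s \<le> t"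
  unfolding R_stat_def[abs_def] using that
  by (intro borel_measurable_times borel_measurable_prod borel_measurable_divide borel_measurable_diff
      measurable_trans_prob measurable_lik_ratio measurable_X_obs measurable_Y_obs) auto

lemma R_stat_nonneg: "w \<in> space M \<Longrightarrow> 0 \<le> R_stat f g \<pi> X Y s t w"
  unfolding R_stat_def
  by (intro mult_nonneg_nonneg prod_nonneg divide_nonneg_nonneg ballI)
     (simp_all add: trans_prob_range lik_ratio_nonneg less_imp_le)

lemma R_stat_Suc:
  "s \<le> t \<Longrightarrow> R_stat f g \<pi> X Y s (Suc t) w =
     R_stat f g \<pi> X Y s t w * (lik_ratio f g X Y (Suc t) w / (1 - trans_prob \<pi> X (Suc t) w))"
  by (simp add: R_stat_def)

section \<open>Transition and response steps\<close>

lemma measurable_theta_Collect: "{w \<in> space M. P (\<theta> w)} \<in> sets M"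
  using measurable_sets[OF meas_theta, of "Collect P"] by (simp add: vimage_def Int_def conj_commute)

lemma latent_eq_0_iff: "latent \<theta> t w = 0 \<longleftrightarrow> enat t < \<theta> w"
  by (simp add: latent_def)

lemma latent_eq_1_iff: "latent \<theta> t w = 1 \<longleftrightarrow> \<theta> w \<le> enat t"
  by (auto simp: latent_def not_less)

lemma sets_after_trans: "{w \<in> space M. \<theta> w > enat t} \<in> sets (trans_alg_at (Suc t))"
  using measurable_sets[OF measurable_latent_trans, of "{0}" t]
  by (simp add: space_trans vimage_def Int_def conj_commute latent_eq_0_iff)

lemma sets_after_resp: "i \<le> Suc t \<Longrightarrow> {w \<in> space M. \<theta> w > enat i} \<in> sets (resp_alg_at (Suc t))"
  using measurable_sets[OF measurable_latent_resp[of i t], of "{0}"]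
  by (simp add: space_resp vimage_def Int_def conj_commute latent_eq_0_iff)

lemma sets_at_resp:
  assumes "s \<le> Suc t"
  shows "{w \<in> space M. \<theta> w = enat s} \<in> sets (resp_alg_at (Suc t))"
proof (cases s)
  case 0
  have "{w \<in> space M. \<theta> w = enat s} = space (resp_alg_at (Suc t)) - {w \<in> space M. \<theta> w > enat 0}"
    by (auto simp: space_resp 0 zero_enat_def[symmetric])
  then show ?thesis
    using sets_after_resp[of 0 t] by auto
next
  case (Suc r)
  have "\<theta> w = enat (Suc r) \<longleftrightarrow> \<theta> w > enat r \<and> \<not> \<theta> w > enat (Suc r)" for w
    by (cases "\<theta> w") auto
  then have "{w \<in> space M. \<theta> w = enat s} = {w \<in> space M. \<theta> w > enat r} - {w \<in> space M. \<theta> w > enat s}"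
    by (auto simp: Suc)
  then show ?thesis
    using sets_after_resp[of r t] sets_after_resp[of s t] assms Suc by auto
qed

lemma trans_step:
  assumes Z [measurable]: "Z \<in> borel_measurable (trans_alg_at (Suc t))"
  shows trans_step_at: "(\<integral>\<^sup>+w. Z w * indicator {w \<in> space M. \<theta> w = enat (Suc t)} w \<partial>M) =
      (\<integral>\<^sup>+w. Z w * ennreal (trans_prob \<pi> X (Suc t) w) * indicator {w \<in> space M. \<theta> w > enat t} w \<partial>M)"
    and trans_step_after: "(\<integral>\<^sup>+w. Z w * indicator {w \<in> space M. \<theta> w > enat (Suc t)} w \<partial>M) =
      (\<integral>\<^sup>+w. Z w * ennreal (1 - trans_prob \<pi> X (Suc t) w) * indicator {w \<in> space M. \<theta> w > enat t} w \<partial>M)"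
proof -
  define Z' where "Z' w = Z w * indicator {w \<in> space M. \<theta> w > enat t} w" for w
  define C where "C = {w \<in> space M. latent \<theta> (Suc t) w = 1}"
  have sub: "subalgebra M (trans_alg_at (Suc t))" by (rule subalgebra_trans) simp
  have C: "C \<in> sets M"
    unfolding C_def latent_eq_1_iff by (rule measurable_theta_Collect)
  have [measurable]: "{w \<in> space M. \<theta> w > enat t} \<in> sets (trans_alg_at (Suc t))"
    by (rule sets_after_trans)
  have Z': "Z' \<in> borel_measurable (trans_alg_at (Suc t))"
    unfolding Z'_def[abs_def] by measurable
  have q: "AE w in M. Z' w \<noteq> 0 \<longrightarrow>
      real_cond_exp M (trans_alg_at (Suc t)) (indicator C) w = trans_prob \<pi> X (Suc t) w"
    using trans_L[of "Suc t"] unfolding C_def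
    by simp (elim AE_mp, intro AE_I2 impI, auto simp: Z'_def indicator_def latent_eq_0_iff split: if_splits)
  have q': "AE w in M. Z' w \<noteq> 0 \<longrightarrow>
      real_cond_exp M (trans_alg_at (Suc t)) (indicator (space M - C)) w = 1 - trans_prob \<pi> X (Suc t) w"
    using q real_cond_exp_compl[OF sub C] by eventually_elim simp
  have Suc_iff: "\<theta> w = enat (Suc t) \<longleftrightarrow> \<theta> w > enat t \<and> \<theta> w \<le> enat (Suc t)"
    "\<theta> w > enat (Suc t) \<longleftrightarrow> \<theta> w > enat t \<and> \<not> \<theta> w \<le> enat (Suc t)" for w
    by (cases "\<theta> w"; auto)+
  have "(\<integral>\<^sup>+w. Z w * indicator {w \<in> space M. \<theta> w = enat (Suc t)} w \<partial>M) = (\<integral>\<^sup>+w. Z' w * indicator C w \<partial>M)"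
    unfolding C_def latent_eq_1_iff Z'_def
    by (rule nn_integral_cong) (simp only: indicator_def mem_Collect_eq Suc_iff, simp)
  also have "\<dots> = (\<integral>\<^sup>+w. Z' w * ennreal (trans_prob \<pi> X (Suc t) w) \<partial>M)"
    by (rule nn_integral_cond_prob[OF sub C Z' q])
  finally show "(\<integral>\<^sup>+w. Z w * indicator {w \<in> space M. \<theta> w = enat (Suc t)} w \<partial>M) =
      (\<integral>\<^sup>+w. Z w * ennreal (trans_prob \<pi> X (Suc t) w) * indicator {w \<in> space M. \<theta> w > enat t} w \<partial>M)"
    by (simp add: Z'_def ac_simps)
  have C': "space M - C \<in> sets M" using C by auto
  have "(\<integral>\<^sup>+w. Z w * indicator {w \<in> space M. \<theta> w > enat (Suc t)} w \<partial>M) =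
      (\<integral>\<^sup>+w. Z' w * indicator (space M - C) w \<partial>M)"
    unfolding C_def latent_eq_1_iff Z'_def
    by (rule nn_integral_cong) (simp only: indicator_def mem_Collect_eq Diff_iff Suc_iff, simp)
  also have "\<dots> = (\<integral>\<^sup>+w. Z' w * ennreal (1 - trans_prob \<pi> X (Suc t) w) \<partial>M)"
    by (rule nn_integral_cond_prob[OF sub C' Z' q'])
  finally show "(\<integral>\<^sup>+w. Z w * indicator {w \<in> space M. \<theta> w > enat (Suc t)} w \<partial>M) =
      (\<integral>\<^sup>+w. Z w * ennreal (1 - trans_prob \<pi> X (Suc t) w) * indicator {w \<in> space M. \<theta> w > enat t} w \<partial>M)"
    by (simp add: Z'_def ac_simps)
qed

lemma measurable_trans_prob_trans: "trans_prob \<pi> X (Suc t) \<in> borel_measurable (trans_alg_at (Suc t))"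
  by (rule obs_trans, rule measurable_trans_prob, rule measurable_X_Suc_obs)

lemma trans_step_divide:
  assumes Z: "Z \<in> borel_measurable (trans_alg_at (Suc t))"
    and p: "p \<in> borel_measurable (trans_alg_at (Suc t))" "\<And>w. w \<in> space M \<Longrightarrow> 0 \<le> p w"
  shows "(\<integral>\<^sup>+w. Z w * ennreal (p w) * indicator {w \<in> space M. \<theta> w > enat t} w \<partial>M) =
      (\<integral>\<^sup>+w. Z w * ennreal (p w / (1 - trans_prob \<pi> X (Suc t) w)) *
         indicator {w \<in> space M. \<theta> w > enat (Suc t)} w \<partial>M)"
proof -
  define Z' where "Z' w = Z w * ennreal (p w / (1 - trans_prob \<pi> X (Suc t) w))" for w
  have Z': "Z' \<in> borel_measurable (trans_alg_at (Suc t))"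
    unfolding Z'_def[abs_def]
    by (intro borel_measurable_times_ennreal Z measurable_compose[OF _ measurable_ennreal]
        borel_measurable_divide p borel_measurable_diff measurable_trans_prob_trans borel_measurable_const)
  have "(\<integral>\<^sup>+w. Z' w * indicator {w \<in> space M. \<theta> w > enat (Suc t)} w \<partial>M) =
    (\<integral>\<^sup>+w. Z' w * ennreal (1 - trans_prob \<pi> X (Suc t) w) * indicator {w \<in> space M. \<theta> w > enat t} w \<partial>M)"
    by (rule trans_step_after[OF Z'])
  also have "\<dots> = (\<integral>\<^sup>+w. Z w * ennreal (p w) * indicator {w \<in> space M. \<theta> w > enat t} w \<partial>M)"
  proof (rule nn_integral_cong)
    fix w assume w: "w \<in> space M"
    have "ennreal (p w / (1 - trans_prob \<pi> X (Suc t) w)) * ennreal (1 - trans_prob \<pi> X (Suc t) w) = ennreal (p w)"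
      using trans_prob_range[OF w, of "Suc t"] p(2)[OF w] by (subst ennreal_mult[symmetric]) auto
    then show "Z' w * ennreal (1 - trans_prob \<pi> X (Suc t) w) * indicator {w \<in> space M. \<theta> w > enat t} w =
        Z w * ennreal (p w) * indicator {w \<in> space M. \<theta> w > enat t} w"
      by (simp add: Z'_def mult.assoc)
  qed
  finally show ?thesis
    by (simp only: Z'_def)
qed

lemma trans_step_at_odds:
  assumes Z: "Z \<in> borel_measurable (trans_alg_at (Suc t))"
  shows "(\<integral>\<^sup>+w. Z w * indicator {w \<in> space M. \<theta> w = enat (Suc t)} w \<partial>M) =
      (\<integral>\<^sup>+w. Z w * ennreal (trans_prob \<pi> X (Suc t) w / (1 - trans_prob \<pi> X (Suc t) w)) *
         indicator {w \<in> space M. \<theta> w > enat (Suc t)} w \<partial>M)"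
  unfolding trans_step_at[OF Z]
  by (rule trans_step_divide[OF Z measurable_trans_prob_trans trans_prob_range(1)])

lemma resp_step_treatment:
  assumes Z: "Z \<in> borel_measurable (resp_alg_at (Suc t))"
    and h_def: "h = (if i = 0 then f x else g x)" and x: "x \<in> {1..K}"
    and supp: "\<And>w. w \<in> space M \<Longrightarrow> Z w \<noteq> 0 \<Longrightarrow> X (Suc t) w = x \<and> latent \<theta> (Suc t) w = i"
    and \<psi>: "\<psi> \<in> borel_measurable borel"
  shows "(\<integral>\<^sup>+w. Z w * \<psi> (Y (Suc t) w) \<partial>M) = (\<integral>\<^sup>+w. Z w \<partial>M) * (\<integral>\<^sup>+y. \<psi> y * ennreal (h y) \<partial>\<mu>)"
proof -
  note [measurable] = meas_Y[of "Suc t", simplified] sets_mu[measurable_cong] \<psi>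
  have ZM [measurable]: "Z \<in> borel_measurable M"
    by (rule resp_M[OF Z])
  have "is_density \<mu> h" using dens_f dens_g x h_def by auto
  then have h [measurable]: "h \<in> borel_measurable borel" and h1: "(\<integral>\<^sup>+y. ennreal (h y) \<partial>\<mu>) = 1"
    by (auto simp: is_density_def measurable_cong_sets[OF sets_mu refl])
  have sub: "subalgebra M (resp_alg_at (Suc t))" by (rule subalgebra_resp) simp
  interpret D: prob_space "density \<mu> (\<lambda>y. ennreal (h y))"
    by (rule prob_spaceI) (simp add: emeasure_density h1 cong: nn_integral_cong)
  have "distr (density M Z) borel (Y (Suc t)) = scale_measure (\<integral>\<^sup>+w. Z w \<partial>M) (density \<mu> (\<lambda>y. ennreal (h y)))"
  proof (rule measure_eqI)
    fix B assume "B \<in> sets (distr (density M Z) borel (Y (Suc t)))"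
    then have B [measurable]: "B \<in> sets borel" by simp
    define C where "C = {w \<in> space M. Y (Suc t) w \<in> B}"
    have C [measurable]: "C \<in> sets M" unfolding C_def by measurable
    have "AE w in M. Z w \<noteq> 0 \<longrightarrow> real_cond_exp M (resp_alg_at (Suc t)) (indicator C) w =
        measure (density \<mu> (\<lambda>y. ennreal (h y))) B"
      using resp_Y[of "Suc t" B] unfolding C_def
      by simp (elim AE_mp, intro AE_I2 impI, use supp in \<open>auto simp: h_def\<close>)
    then have "(\<integral>\<^sup>+w. Z w * indicator C w \<partial>M) =
        (\<integral>\<^sup>+w. Z w * ennreal (measure (density \<mu> (\<lambda>y. ennreal (h y))) B) \<partial>M)"
      by (rule nn_integral_cond_prob[OF sub C Z])
    also have "\<dots> = (\<integral>\<^sup>+w. Z w \<partial>M) * emeasure (density \<mu> (\<lambda>y. ennreal (h y))) B"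
      by (simp add: nn_integral_multc D.emeasure_eq_measure)
    finally have eq: "(\<integral>\<^sup>+w. Z w * indicator C w \<partial>M) =
        (\<integral>\<^sup>+w. Z w \<partial>M) * emeasure (density \<mu> (\<lambda>y. ennreal (h y))) B" .
    have "Y (Suc t) -` B \<inter> space M = C" by (auto simp: C_def)
    then show "emeasure (distr (density M Z) borel (Y (Suc t))) B =
        emeasure (scale_measure (\<integral>\<^sup>+w. Z w \<partial>M) (density \<mu> (\<lambda>y. ennreal (h y)))) B"
      by (simp add: emeasure_distr emeasure_density[of Z] eq)
  qed (simp add: sets_mu)
  then have "(\<integral>\<^sup>+y. \<psi> y \<partial>distr (density M Z) borel (Y (Suc t))) =
      (\<integral>\<^sup>+y. \<psi> y \<partial>scale_measure (\<integral>\<^sup>+w. Z w \<partial>M) (density \<mu> (\<lambda>y. ennreal (h y))))"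
    by simp
  then show ?thesis
    by (simp add: nn_integral_distr nn_integral_density nn_integral_scale_measure mult.commute)
qed

lemma measurable_X_Suc_resp: "X (Suc t) \<in> measurable (resp_alg_at (Suc t)) (count_space {1..K})"
  by (rule trans_resp, rule obs_trans, rule measurable_X_Suc_obs) simp

lemma resp_step:
  assumes Z: "Z \<in> borel_measurable (resp_alg_at (Suc t))"
    and h_def: "\<And>x. h x = (if i = 0 then f x else g x)"
    and supp: "\<And>w. w \<in> space M \<Longrightarrow> Z w \<noteq> 0 \<Longrightarrow> latent \<theta> (Suc t) w = i"
    and \<psi>: "\<And>x. x \<in> {1..K} \<Longrightarrow> \<psi> x \<in> borel_measurable borel"
  shows "(\<integral>\<^sup>+w. Z w * \<psi> (X (Suc t) w) (Y (Suc t) w) \<partial>M) =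
    (\<integral>\<^sup>+w. Z w * (\<integral>\<^sup>+y. \<psi> (X (Suc t) w) y * ennreal (h (X (Suc t) w) y) \<partial>\<mu>) \<partial>M)"
proof -
  define I where "I x w = (indicator {x} (X (Suc t) w) :: ennreal)" for x w
  have I [measurable]: "I x \<in> borel_measurable (resp_alg_at (Suc t))" for x
    unfolding I_def[abs_def]
    by (rule measurable_compose[OF measurable_X_Suc_resp]) simp
  have ZI: "(\<lambda>w. Z w * I x w) \<in> borel_measurable (resp_alg_at (Suc t))" for x
    using Z by measurable
  have split: "a (X (Suc t) w) = (\<Sum>x\<in>{1..K}. I x w * a x)" if "w \<in> space M" for w and a :: "nat \<Rightarrow> ennreal"
    using X_range[OF _ that, of "Suc t"] by (simp add: I_def indicator_def if_distrib sum.delta' cong: if_cong)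
  note [measurable] = meas_Y[of "Suc t", simplified] resp_M[OF Z] resp_M[OF I]
  have "(\<integral>\<^sup>+w. Z w * \<psi> (X (Suc t) w) (Y (Suc t) w) \<partial>M) =
      (\<integral>\<^sup>+w. (\<Sum>x\<in>{1..K}. Z w * I x w * \<psi> x (Y (Suc t) w)) \<partial>M)"
    by (rule nn_integral_cong)
       (subst split[of _ "\<lambda>x. \<psi> x (Y (Suc t) _)"], auto simp: sum_distrib_left mult.assoc)
  also have "\<dots> = (\<Sum>x\<in>{1..K}. \<integral>\<^sup>+w. Z w * I x w * \<psi> x (Y (Suc t) w) \<partial>M)"
    by (rule nn_integral_sum) (use measurable_compose[OF meas_Y \<psi>] in auto)
  also have "\<dots> = (\<Sum>x\<in>{1..K}. \<integral>\<^sup>+w. Z w * I x w * (\<integral>\<^sup>+y. \<psi> x y * ennreal (h x y) \<partial>\<mu>) \<partial>M)"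
  proof (rule sum.cong[OF refl])
    fix x assume x: "x \<in> {1..K}"
    have "(\<integral>\<^sup>+w. Z w * I x w * \<psi> x (Y (Suc t) w) \<partial>M) =
        (\<integral>\<^sup>+w. Z w * I x w \<partial>M) * (\<integral>\<^sup>+y. \<psi> x y * ennreal (h x y) \<partial>\<mu>)"
      by (rule resp_step_treatment[OF ZI h_def x _ \<psi>[OF x]])
         (use supp in \<open>auto simp: I_def indicator_def split: if_splits\<close>)
    then show "(\<integral>\<^sup>+w. Z w * I x w * \<psi> x (Y (Suc t) w) \<partial>M) =
        (\<integral>\<^sup>+w. Z w * I x w * (\<integral>\<^sup>+y. \<psi> x y * ennreal (h x y) \<partial>\<mu>) \<partial>M)"
      by (simp add: nn_integral_multc)
  qed
  also have "\<dots> = (\<integral>\<^sup>+w. (\<Sum>x\<in>{1..K}. Z w * I x w * (\<integral>\<^sup>+y. \<psi> x y * ennreal (h x y) \<partial>\<mu>)) \<partial>M)"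
    by (rule nn_integral_sum[symmetric]) auto
  also have "\<dots> = (\<integral>\<^sup>+w. Z w * (\<integral>\<^sup>+y. \<psi> (X (Suc t) w) y * ennreal (h (X (Suc t) w) y) \<partial>\<mu>) \<partial>M)"
    by (rule nn_integral_cong)
       (subst split[of _ "\<lambda>x. \<integral>\<^sup>+y. \<psi> x y * ennreal (h x y) \<partial>\<mu>"], auto simp: sum_distrib_left mult.assoc)
  finally show ?thesis .
qed

definition post_mass :: "'y set \<Rightarrow> nat \<Rightarrow> ennreal" where
  "post_mass B x = (\<integral>\<^sup>+y. indicator B y * ennreal (g x y) \<partial>\<mu>)"

lemma measurable_post_mass_X:
  "(\<lambda>w. post_mass B (X (Suc t) w)) \<in> borel_measurable (obs t)"
  by (rule measurable_compose[OF measurable_X_Suc_obs]) auto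

lemma resp_step_after_change:
  assumes Z: "Z \<in> borel_measurable (resp_alg_at (Suc t))" and B: "B \<in> sets borel"
    and supp: "\<And>w. w \<in> space M \<Longrightarrow> Z w \<noteq> 0 \<Longrightarrow> latent \<theta> (Suc t) w = 1"
  shows "(\<integral>\<^sup>+w. Z w * indicator B (Y (Suc t) w) \<partial>M) = (\<integral>\<^sup>+w. Z w * post_mass B (X (Suc t) w) \<partial>M)"
  unfolding post_mass_def
  by (rule resp_step[OF Z, where \<psi> = "\<lambda>_. indicator B" and i = 1]) (use supp B in auto)

lemma resp_step_before_change:
  assumes Z: "Z \<in> borel_measurable (resp_alg_at (Suc t))" and B [measurable]: "B \<in> sets borel"
    and supp: "\<And>w. w \<in> space M \<Longrightarrow> Z w \<noteq> 0 \<Longrightarrow> latent \<theta> (Suc t) w = 0"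
  shows "(\<integral>\<^sup>+w. Z w * (indicator B (Y (Suc t) w) * ennreal (lik_ratio f g X Y (Suc t) w)) \<partial>M) =
    (\<integral>\<^sup>+w. Z w * post_mass B (X (Suc t) w) \<partial>M)"
proof -
  have mass: "(\<integral>\<^sup>+y. indicator B y * ennreal (g x y / f x y) * ennreal (f x y) \<partial>\<mu>) = post_mass B x"
    if x: "x \<in> {1..K}" for x
    unfolding post_mass_def
  proof (rule nn_integral_cong_AE, use same_zeros[OF x] in eventually_elim)
    fix y assume "f x y = 0 \<longleftrightarrow> g x y = 0"
    then have "ennreal (g x y / f x y) * ennreal (f x y) = ennreal (g x y)"
      using f_nonneg[OF x] g_nonneg[OF x] by (subst ennreal_mult[symmetric]) auto
    then show "indicator B y * ennreal (g x y / f x y) * ennreal (f x y) = indicator B y * ennreal (g x y)"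
      by (simp add: mult.assoc)
  qed
  have "(\<integral>\<^sup>+w. Z w * (indicator B (Y (Suc t) w) * ennreal (lik_ratio f g X Y (Suc t) w)) \<partial>M) =
      (\<integral>\<^sup>+w. Z w * (\<integral>\<^sup>+y. indicator B y * ennreal (g (X (Suc t) w) y / f (X (Suc t) w) y) *
         ennreal (f (X (Suc t) w) y) \<partial>\<mu>) \<partial>M)"
    unfolding lik_ratio_def
    using resp_step[OF Z, where \<psi> = "\<lambda>x y. indicator B y * ennreal (g x y / f x y)" and i = 0, OF _ supp]
      measurable_f measurable_g by simp
  also have "\<dots> = (\<integral>\<^sup>+w. Z w * post_mass B (X (Suc t) w) \<partial>M)"
    using X_range[of "Suc t"] by (intro nn_integral_cong) (simp add: mass)
  finally show ?thesis .
qed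

section \<open>Change of measure\<close>

lemma obs_Suc_generators:
  fixes t :: nat
  defines "E \<equiv> {A \<inter> (Y (Suc t) -` B \<inter> space M) | A B. A \<in> sets (obs t) \<and> B \<in> sets borel}"
  shows "Int_stable E" "E \<subseteq> sets M" "space M \<in> E" "sets (obs (Suc t)) \<subseteq> sigma_sets (space M) E"
proof -
  show "Int_stable E"
  proof (rule Int_stableI)
    fix a b assume "a \<in> E" "b \<in> E"
    then obtain A B A' B' where *: "A \<in> sets (obs t)" "B \<in> sets borel" "A' \<in> sets (obs t)" "B' \<in> sets borel"
      and eq: "a = A \<inter> (Y (Suc t) -` B \<inter> space M)" "b = A' \<inter> (Y (Suc t) -` B' \<inter> space M)"
      unfolding E_def mem_Collect_eq by (elim exE conjE) (rule that)
    have "a \<inter> b = (A \<inter> A') \<inter> (Y (Suc t) -` (B \<inter> B') \<inter> space M)"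
      unfolding eq by auto
    moreover have "A \<inter> A' \<in> sets (obs t)" "B \<inter> B' \<in> sets borel"
      using * by auto
    ultimately show "a \<inter> b \<in> E"
      unfolding E_def mem_Collect_eq by (intro exI conjI)
  qed
  show EM: "E \<subseteq> sets M"
  proof
    fix a assume "a \<in> E"
    then obtain A B where a: "a = A \<inter> (Y (Suc t) -` B \<inter> space M)" "A \<in> sets (obs t)" "B \<in> sets borel"
      unfolding E_def by blast
    show "a \<in> sets M"
      unfolding a(1)
      by (rule sets.Int[OF subsetD[OF sets_obs a(2)] measurable_sets[OF meas_Y a(3)]]) simp
  qed
  have E_I: "A \<inter> (Y (Suc t) -` B \<inter> space M) \<in> E" if "A \<in> sets (obs t)" "B \<in> sets borel" for A B
    unfolding E_def using that by blast
  have obs_E: "A \<in> E" if "A \<in> sets (obs t)" for A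
  proof -
    have "A \<inter> (Y (Suc t) -` UNIV \<inter> space M) = A"
      using sets.sets_into_space[OF that] by (simp add: Int_absorb2)
    then show ?thesis
      using E_I[OF that, of UNIV] by simp
  qed
  show "space M \<in> E"
    using obs_E[OF sets.top] by simp
  have Y_E: "Y (Suc t) -` B \<inter> space M \<in> E" if "B \<in> sets borel" for B
  proof -
    have "space (obs t) \<inter> (Y (Suc t) -` B \<inter> space M) = Y (Suc t) -` B \<inter> space M"
      by auto
    then show ?thesis
      using E_I[OF sets.top that] by simp
  qed
  have "E \<subseteq> Pow (space M)"
    using EM sets.space_closed by (rule subset_trans)
  then have sets_E: "sets (sigma (space M) E) = sigma_sets (space M) E"
    by (rule sets_measure_of)
  have X_E: "X i \<in> measurable (sigma (space M) E) (count_space UNIV)" if "i \<in> {1..Suc t}" for i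
  proof -
    have "X i \<in> measurable (sigma (space M) E) (count_space {1..K})"
      by (rule measurable_mono_sets[OF measurable_X_Suc_obs[OF that]])
         (auto simp: sets_E space_measure_of_conv intro: obs_E)
    then show ?thesis
      by (rule measurable_compose) simp
  qed
  have Y'_E: "Y i \<in> borel_measurable (sigma (space M) E)" if "i \<in> {1..Suc t}" for i
  proof (cases "i = Suc t")
    case True
    show ?thesis
      unfolding True by (rule measurableI) (auto simp: sets_E space_measure_of_conv intro: Y_E)
  next
    case False
    then have "i \<in> {1..t}" using that by auto
    then show ?thesis
      by (intro measurable_mono_sets[OF measurable_Y_obs])
         (auto simp: sets_E space_measure_of_conv intro: obs_E)
  qed
  have "sets (obs (Suc t)) \<subseteq> sets (sigma (space M) E)"
    unfolding obs_alg_def sets_measure_of[OF obs_generators_Pow] sets_E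
    by (rule sigma_sets_mono, unfold sets_E[symmetric], intro UN_least Un_least sets_image_in_sets X_E Y'_E)
       (simp_all add: space_measure_of_conv)
  then show "sets (obs (Suc t)) \<subseteq> sigma_sets (space M) E"
    by (simp add: sets_E)
qed

lemma obs_0: "sets (obs 0) = {{}, space M}"
  by (simp add: obs_alg_def sigma_sets_empty_eq)

lemma change_of_measure_generator:
  assumes A: "A \<in> sets (obs t)" and B: "B \<in> sets borel" and s: "s \<le> Suc t"
    and c: "c \<in> borel_measurable (trans_alg_at (Suc t))" "\<And>w. w \<in> space M \<Longrightarrow> 0 \<le> c w"
    and R: "\<And>w. w \<in> space M \<Longrightarrow> R_stat f g \<pi> X Y s (Suc t) w = c w * lik_ratio f g X Y (Suc t) w"
    and step: "\<And>V. V \<in> borel_measurable (obs t) \<Longrightarrow>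
      (\<integral>\<^sup>+w. V w * indicator {w \<in> space M. \<theta> w = enat s} w \<partial>M) =
      (\<integral>\<^sup>+w. V w * ennreal (c w) * indicator {w \<in> space M. \<theta> w > enat (Suc t)} w \<partial>M)"
  shows "(\<integral>\<^sup>+w. indicator (A \<inter> (Y (Suc t) -` B \<inter> space M)) w * indicator {w \<in> space M. \<theta> w = enat s} w \<partial>M) =
    (\<integral>\<^sup>+w. indicator (A \<inter> (Y (Suc t) -` B \<inter> space M)) w * (ennreal (R_stat f g \<pi> X Y s (Suc t) w) *
       indicator {w \<in> space M. \<theta> w > enat (Suc t)} w) \<partial>M)"
proof -
  define Is :: "'a \<Rightarrow> ennreal" where "Is = indicator {w \<in> space M. \<theta> w = enat s}"
  define It :: "'a \<Rightarrow> ennreal" where "It = indicator {w \<in> space M. \<theta> w > enat (Suc t)}"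
  define G where "G w = post_mass B (X (Suc t) w)" for w
  have IA: "(indicator A :: 'a \<Rightarrow> ennreal) \<in> borel_measurable (obs t)"
    using A by simp
  have Is: "(\<lambda>w. indicator A w * Is w) \<in> borel_measurable (resp_alg_at (Suc t))"
    unfolding Is_def
    by (intro borel_measurable_times_ennreal trans_resp[OF obs_trans[OF IA]]
        borel_measurable_indicator sets_at_resp s)
  have It: "(\<lambda>w. indicator A w * ennreal (c w) * It w) \<in> borel_measurable (resp_alg_at (Suc t))"
    unfolding It_def
    by (intro borel_measurable_times_ennreal trans_resp[OF obs_trans[OF IA]]
        measurable_compose[OF _ measurable_ennreal] trans_resp[OF c(1)]
        borel_measurable_indicator sets_after_resp order_refl)
  have AG: "(\<lambda>w. indicator A w * G w) \<in> borel_measurable (obs t)"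
    unfolding G_def by (intro borel_measurable_times_ennreal IA measurable_post_mass_X)
  have "(\<integral>\<^sup>+w. indicator (A \<inter> (Y (Suc t) -` B \<inter> space M)) w * Is w \<partial>M) =
      (\<integral>\<^sup>+w. indicator A w * Is w * indicator B (Y (Suc t) w) \<partial>M)"
    by (rule nn_integral_cong) (auto simp: indicator_def)
  also have "\<dots> = (\<integral>\<^sup>+w. indicator A w * Is w * G w \<partial>M)"
    unfolding G_def
  proof (rule resp_step_after_change[OF Is B])
    fix w assume "indicator A w * Is w \<noteq> 0"
    then show "latent \<theta> (Suc t) w = 1"
      using s by (auto simp: Is_def indicator_def latent_def split: if_splits)
  qed
  also have "\<dots> = (\<integral>\<^sup>+w. indicator A w * G w * Is w \<partial>M)"
    by (simp only: ac_simps)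
  also have "\<dots> = (\<integral>\<^sup>+w. indicator A w * G w * ennreal (c w) * It w \<partial>M)"
    unfolding Is_def It_def by (rule step[OF AG])
  also have "\<dots> = (\<integral>\<^sup>+w. indicator A w * ennreal (c w) * It w * G w \<partial>M)"
    by (simp only: ac_simps)
  also have "\<dots> = (\<integral>\<^sup>+w. indicator A w * ennreal (c w) * It w *
      (indicator B (Y (Suc t) w) * ennreal (lik_ratio f g X Y (Suc t) w)) \<partial>M)"
    unfolding G_def
  proof (rule resp_step_before_change[OF It B, symmetric])
    fix w assume "indicator A w * ennreal (c w) * It w \<noteq> 0"
    then show "latent \<theta> (Suc t) w = 0"
      by (auto simp: It_def indicator_def latent_def split: if_splits)
  qed
  also have "\<dots> = (\<integral>\<^sup>+w. indicator (A \<inter> (Y (Suc t) -` B \<inter> space M)) w *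
      (ennreal (R_stat f g \<pi> X Y s (Suc t) w) * It w) \<partial>M)"
  proof (rule nn_integral_cong)
    fix w assume w: "w \<in> space M"
    have "ennreal (R_stat f g \<pi> X Y s (Suc t) w) = ennreal (c w) * ennreal (lik_ratio f g X Y (Suc t) w)"
      using R[OF w] c(2)[OF w] lik_ratio_nonneg[OF w] by (simp add: ennreal_mult)
    moreover have "indicator (A \<inter> (Y (Suc t) -` B \<inter> space M)) w = (indicator A w * indicator B (Y (Suc t) w) :: ennreal)"
      using w by (auto simp: indicator_def)
    ultimately show "indicator A w * ennreal (c w) * It w *
        (indicator B (Y (Suc t) w) * ennreal (lik_ratio f g X Y (Suc t) w)) =
      indicator (A \<inter> (Y (Suc t) -` B \<inter> space M)) w * (ennreal (R_stat f g \<pi> X Y s (Suc t) w) * It w)"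
      by (simp only: ac_simps)
  qed
  finally show ?thesis
    unfolding Is_def It_def .
qed

lemma change_of_measure:
  assumes "s \<le> t" "h \<in> borel_measurable (obs t)"
  shows "(\<integral>\<^sup>+w. h w * indicator {w \<in> space M. \<theta> w = enat s} w \<partial>M) =
    (\<integral>\<^sup>+w. h w * (ennreal (R_stat f g \<pi> X Y s t w) * indicator {w \<in> space M. \<theta> w > enat t} w) \<partial>M)"
  using assms
proof (induction t arbitrary: h)
  case 0
  then have s: "s = 0" by simp
  define p where "p = \<pi> 0 (\<lambda>_. undefined)"
  have p: "0 \<le> p" "p < 1"
    using pi_range[of "\<lambda>_. undefined" 0] by (auto simp: p_def)
  have R: "R_stat f g \<pi> X Y 0 0 w = p / (1 - p)" for w
    by (simp add: R_stat_def trans_prob_def lik_ratio_def p_def restrict_def)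
  have at: "prob {w \<in> space M. \<theta> w = enat 0} = p"
    using init_L[unfolded latent_eq_1_iff] by (simp add: p_def zero_enat_def[symmetric])
  have "{w \<in> space M. \<theta> w > enat 0} = space M - {w \<in> space M. \<theta> w = enat 0}"
    by (auto simp: zero_enat_def[symmetric])
  then have after: "prob {w \<in> space M. \<theta> w > enat 0} = 1 - p"
    using prob_compl[OF measurable_theta_Collect, of "\<lambda>x. x = enat 0"] at by simp
  have meas [measurable]: "{w \<in> space M. \<theta> w = enat 0} \<in> sets M" "{w \<in> space M. \<theta> w > enat 0} \<in> sets M"
    by (rule measurable_theta_Collect)+
  show ?case
    unfolding s
  proof (rule nn_integral_eq_from_Int_stable[of _ _ _ "{{}, space M}" "obs 0"])
    show "Int_stable {{}, space M}" by (auto simp: Int_stable_def)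
    show "sets (obs 0) \<subseteq> sigma_sets (space M) {{}, space M}"
      unfolding obs_0 by (rule sigma_sets_superset_generator)
    have one: "(\<integral>\<^sup>+w. indicator {w \<in> space M. \<theta> w = enat 0} w \<partial>M) = ennreal p"
      by (simp add: emeasure_eq_measure at)
    then show "(\<integral>\<^sup>+w. indicator {w \<in> space M. \<theta> w = enat 0} w \<partial>M) < \<infinity>"
      by simp
    have two: "(\<integral>\<^sup>+w. ennreal (R_stat f g \<pi> X Y 0 0 w) * indicator {w \<in> space M. \<theta> w > enat 0} w \<partial>M) = ennreal p"
      using p by (simp add: R emeasure_eq_measure nn_integral_cmult_indicator after ennreal_mult[symmetric])
    fix A assume "A \<in> {{}, space M}"
    then show "(\<integral>\<^sup>+w. indicator A w * indicator {w \<in> space M. \<theta> w = enat 0} w \<partial>M) =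
       (\<integral>\<^sup>+w. indicator A w * (ennreal (R_stat f g \<pi> X Y 0 0 w) * indicator {w \<in> space M. \<theta> w > enat 0} w) \<partial>M)"
      using one two by (auto cong: nn_integral_cong_simp)
  qed (use 0 in \<open>auto simp: R[abs_def]\<close>)
next
  case (Suc t)
  define E where "E = {A \<inter> (Y (Suc t) -` B \<inter> space M) | A B. A \<in> sets (obs t) \<and> B \<in> sets borel}"
  note E = obs_Suc_generators[of t, folded E_def]
  have [measurable]: "{w \<in> space M. \<theta> w = enat s} \<in> sets M" "{w \<in> space M. \<theta> w > enat (Suc t)} \<in> sets M"
    by (rule measurable_theta_Collect)+
  have [measurable]: "R_stat f g \<pi> X Y s (Suc t) \<in> borel_measurable M"
    by (rule measurable_from_subalg[OF subalgebra_obs measurable_R_stat[OF Suc.prems(1)]])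
  show ?case
  proof (rule nn_integral_eq_from_Int_stable[OF _ _ E(1-3) space_obs E(4) _ _ Suc.prems(2)])
    show "indicator {w \<in> space M. \<theta> w = enat s} \<in> borel_measurable M"
      "(\<lambda>w. ennreal (R_stat f g \<pi> X Y s (Suc t) w) * indicator {w \<in> space M. \<theta> w > enat (Suc t)} w) \<in> borel_measurable M"
      by measurable
    show "(\<integral>\<^sup>+w. indicator {w \<in> space M. \<theta> w = enat s} w \<partial>M) < \<infinity>"
      by (simp add: emeasure_eq_measure)
    fix a assume "a \<in> E"
    then obtain A B where a: "a = A \<inter> (Y (Suc t) -` B \<inter> space M)" and A: "A \<in> sets (obs t)" and B: "B \<in> sets borel"
      unfolding E_def by blast
    show "(\<integral>\<^sup>+w. indicator a w * indicator {w \<in> space M. \<theta> w = enat s} w \<partial>M) =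
       (\<integral>\<^sup>+w. indicator a w * (ennreal (R_stat f g \<pi> X Y s (Suc t) w) *
          indicator {w \<in> space M. \<theta> w > enat (Suc t)} w) \<partial>M)"
    proof (cases "s = Suc t")
      case True
      show ?thesis
        unfolding a
      proof (rule change_of_measure_generator[OF A B Suc.prems(1),
            where c = "\<lambda>w. trans_prob \<pi> X (Suc t) w / (1 - trans_prob \<pi> X (Suc t) w)"])
        show "(\<lambda>w. trans_prob \<pi> X (Suc t) w / (1 - trans_prob \<pi> X (Suc t) w)) \<in> borel_measurable (trans_alg_at (Suc t))"
          by (intro borel_measurable_divide borel_measurable_diff measurable_trans_prob_trans borel_measurable_const)
        show "0 \<le> trans_prob \<pi> X (Suc t) w / (1 - trans_prob \<pi> X (Suc t) w)" if "w \<in> space M" for w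
          using trans_prob_range[OF that] by (simp add: less_imp_le)
        show "R_stat f g \<pi> X Y s (Suc t) w =
            trans_prob \<pi> X (Suc t) w / (1 - trans_prob \<pi> X (Suc t) w) * lik_ratio f g X Y (Suc t) w" for w
          by (simp add: R_stat_def True)
        show "(\<integral>\<^sup>+w. V w * indicator {w \<in> space M. \<theta> w = enat s} w \<partial>M) =
           (\<integral>\<^sup>+w. V w * ennreal (trans_prob \<pi> X (Suc t) w / (1 - trans_prob \<pi> X (Suc t) w)) *
              indicator {w \<in> space M. \<theta> w > enat (Suc t)} w \<partial>M)"
          if "V \<in> borel_measurable (obs t)" for V
          unfolding True by (rule trans_step_at_odds[OF obs_trans[OF that]])
      qed
    next
      case False
      then have s: "s \<le> t" using Suc.prems by simp
      have R: "R_stat f g \<pi> X Y s t \<in> borel_measurable (trans_alg_at (Suc t))"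
        by (rule obs_trans[OF measurable_R_stat[OF s]])
      show ?thesis
        unfolding a
      proof (rule change_of_measure_generator[OF A B Suc.prems(1),
            where c = "\<lambda>w. R_stat f g \<pi> X Y s t w / (1 - trans_prob \<pi> X (Suc t) w)"])
        show "(\<lambda>w. R_stat f g \<pi> X Y s t w / (1 - trans_prob \<pi> X (Suc t) w)) \<in> borel_measurable (trans_alg_at (Suc t))"
          by (intro borel_measurable_divide borel_measurable_diff R measurable_trans_prob_trans borel_measurable_const)
        show "0 \<le> R_stat f g \<pi> X Y s t w / (1 - trans_prob \<pi> X (Suc t) w)" if "w \<in> space M" for w
          using trans_prob_range[OF that] R_stat_nonneg[OF that] by (simp add: less_imp_le)
        show "R_stat f g \<pi> X Y s (Suc t) w =
            R_stat f g \<pi> X Y s t w / (1 - trans_prob \<pi> X (Suc t) w) * lik_ratio f g X Y (Suc t) w" for w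
          by (simp add: R_stat_Suc[OF s])
        show "(\<integral>\<^sup>+w. V w * indicator {w \<in> space M. \<theta> w = enat s} w \<partial>M) =
           (\<integral>\<^sup>+w. V w * ennreal (R_stat f g \<pi> X Y s t w / (1 - trans_prob \<pi> X (Suc t) w)) *
              indicator {w \<in> space M. \<theta> w > enat (Suc t)} w \<partial>M)"
          if V: "V \<in> borel_measurable (obs t)" for V
          using Suc.IH[OF s V] trans_step_divide[OF obs_trans[OF V] R R_stat_nonneg]
          by (simp only: mult.assoc)
      qed
    qed
  qed
qed

end

theorem lemmaA1:
  fixes M :: "'a measure"
    and \<mu> :: "'y :: polish_space measure"
    and K :: nat
    and f g :: "nat \<Rightarrow> 'y \<Rightarrow> real"
    and \<pi> :: "nat \<Rightarrow> (nat \<Rightarrow> nat) \<Rightarrow> real"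
    and X :: "nat \<Rightarrow> 'a \<Rightarrow> nat"
    and Y :: "nat \<Rightarrow> 'a \<Rightarrow> 'y"
    and \<theta> :: "'a \<Rightarrow> enat"
    and s t :: nat
    and u :: "(nat \<Rightarrow> 'y) \<Rightarrow> ennreal"
  assumes "changepoint_model M \<mu> K f g \<pi> X Y \<theta>"
    and "s \<le> t"
    and "u \<in> borel_measurable (Pi\<^sub>M {1..t} (\<lambda>_. borel))"
  shows "(\<integral>\<^sup>+w\<in>{w \<in> space M. \<theta> w = enat s}. u (\<lambda>i\<in>{1..t}. Y i w) \<partial>M) =
         (\<integral>\<^sup>+w\<in>{w \<in> space M. \<theta> w > enat t}.
            (u (\<lambda>i\<in>{1..t}. Y i w) * ennreal (R_stat f g \<pi> X Y s t w)) \<partial>M)"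
proof -
  interpret changepoint_model M \<mu> K f g \<pi> X Y \<theta> by fact
  have "(\<lambda>w. u (\<lambda>i\<in>{1..t}. Y i w)) \<in> borel_measurable (obs t)"
    by (rule measurable_compose[OF measurable_restrict assms(3)]) (rule measurable_Y_obs)
  from change_of_measure[OF assms(2) this] show ?thesis
    by (simp only: mult.assoc)
qed

end
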